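(* Let $f$ be an m-topical map on $\mathbb{R}^n_{\ge 0}$ with upper signature $\overline{f}$ and lower signature $\underline{f}$. Call $x\in\{0,1\}^n$ nontrivial if $x\neq 0$ and $x\neq\mathbf{1}$. \begin{enumerate} \item[(1)] $f$ is facially irreducible if and only if there is no nontrivial $x\in\{0,1\}^n$ such that $\underline{f}(x)\le x$. \item[(2)] $f$ is indecomposable if and only if there is no nontrivial $x\in\{0,1\}^n$ such that $\overline{f}(x)\le x$. \item[(3)] $f$ is partially irreducible if and only if there is no nontrivial $x\in\{0,1\}^n$ such that $\underline{f}(x)=x$. \item[(4)] $f$ is imperturbable if and only if there are no nontrivial $x,y\in\{0,1\}^n$ such that $x\le y$, $\underline{f}(x)\ge x$, and $\overline{f}(y)\le y$. \end{enumerate}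
   Context: Notation: $[n]=\{1,\dots,n\}$; $\mathbb{R}^n_{\ge 0}=[0,\infty)^n$ and $\mathbb{R}^n_{>0}=(0,\infty)^n$; $x\le y$ means $x_i\le y_i$ for all $i\in[n]$; $\mathbf{1}\in\mathbb{R}^n$ is the all-ones vector; for $J\subseteq[n]$, $e_J\in\{0,1\}^n$ has entries $(e_J)_i=1$ if $i\in J$ and $0$ otherwise. A map $f:\mathbb{R}^n_{\ge 0}\to\mathbb{R}^n_{\ge 0}$ is m-topical (multiplicatively topical) if it is continuous, order-preserving ($x\le y$ implies $f(x)\le f(y)$), homogeneous ($f(\lambda x)=\lambda f(x)$ for all real $\lambda>0$), and satisfies $f(\mathbb{R}^n_{>0})\subseteq\mathbb{R}^n_{>0}$. The upper signature of $f$ is the order-preserving function $\overline{f}:\{0,1\}^n\to\{0,1\}^n$ with $\overline{f}(e_J)_i=1$ if and only if $\lim_{t\to\infty}f(\mathbf{1}+te_J)_i=\infty$. The lower signature of $f$ is the order-preserving function $\underline{f}:\{0,1\}^n\to\{0,1\}^n$ with $\underline{f}(e_J)_i=1$ if and only if $f(e_J)_i>0$. For $J\subseteq[n]$ let $F_J=\{x\in\mathbb{R}^n_{\ge 0}: x_i=0 \text{ for all } i\notin J\}$ (closed face) and $P_J=\{x\in\mathbb{R}^n_{\ge 0}: x_i>0 \text{ if and only if } i\in J\}$ (part). $f$ is facially irreducible if there is no $J$ with $\varnothing\ne J\subsetneq[n]$ and $f(F_J)\subseteq F_J$. $f$ is partially irreducible if there is no $J$ with $\varnothing\ne J\subsetneq[n]$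 and $f(P_J)\subseteq P_J$. $f$ is decomposable if there is a nonempty proper subset $J\subset[n]$ such that $\lim_{t\to\infty}f(\mathbf{1}+te_J)_i<\infty$ for all $i\in[n]\setminus J$, and indecomposable if it is not decomposable. $f$ is imperturbable if there are no nonempty subsets $I\subseteq J\subsetneq[n]$ such that $f(e_I)_i>0$ for all $i\in I$ and $\lim_{t\to\infty}f(\mathbf{1}+te_J)_i<\infty$ for all $i\notin J$. *)

theory Defs
  imports "HOL-Analysis.Analysis"
begin

text \<open>
  The index set \<open>[n]\<close> is the universe of a finite type \<open>'n\<close>; the order on \<open>real ^ 'n\<close> is the
  componentwise one and \<open>1 :: real ^ 'n\<close> is the all-ones vector. A self-map of the orthant is
  a total function on \<open>real ^ 'n\<close> of which only the values on the orthant matter.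
\<close>

definition nonneg_orthant :: "(real ^ 'n) set" where
  "nonneg_orthant = {x. \<forall>i. 0 \<le> x $ i}"

definition pos_orthant :: "(real ^ 'n) set" where
  "pos_orthant = {x. \<forall>i. 0 < x $ i}"

definition m_topical :: "(real ^ 'n \<Rightarrow> real ^ 'n) \<Rightarrow> bool" where
  "m_topical f \<longleftrightarrow>
     f ` nonneg_orthant \<subseteq> nonneg_orthant \<and>
     continuous_on nonneg_orthant f \<and>
     (\<forall>x\<in>nonneg_orthant. \<forall>y\<in>nonneg_orthant. x \<le> y \<longrightarrow> f x \<le> f y) \<and>
     (\<forall>x\<in>nonneg_orthant. \<forall>c::real. c > 0 \<longrightarrow> f (c *\<^sub>R x) = c *\<^sub>R f x) \<and>
     f ` pos_orthant \<subseteq> pos_orthant"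

definition ind_vec :: "'n set \<Rightarrow> real ^ 'n" where
  "ind_vec J = (\<chi> i. if i \<in> J then 1 else 0)"

definition binary_vecs :: "(real ^ 'n) set" where
  "binary_vecs = {x. \<forall>i. x $ i = 0 \<or> x $ i = 1}"

definition nontrivial :: "real ^ 'n \<Rightarrow> bool" where
  "nontrivial x \<longleftrightarrow> x \<in> binary_vecs \<and> x \<noteq> 0 \<and> x \<noteq> 1"

lemma binary_vecs_eq_range_ind_vec: "binary_vecs = range ind_vec"
proof (intro equalityI subsetI)
  fix x :: "real ^ 'n"
  assume "x \<in> binary_vecs"
  then have "x = ind_vec {i. x $ i = 1}"
    by (auto simp: binary_vecs_def ind_vec_def vec_eq_iff)
  then show "x \<in> range ind_vec" by blast
qed (auto simp: binary_vecs_def ind_vec_def)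

text \<open>
  The limits of \<open>f (1 + t *\<^sub>R ind_vec J) $ i\<close> as \<open>t\<close> tends to infinity are taken in the extended
  reals, where they exist by monotonicity of \<open>f\<close>. That such a limit is infinite is stated as
  divergence to \<open>at_top\<close>, and that it is finite as convergence to some real number.
  The signatures are meant as maps on \<open>binary_vecs\<close>, whose elements are the vectors
  \<open>ind_vec J\<close>; their values elsewhere are irrelevant.
\<close>

definition upper_signature :: "(real ^ 'n \<Rightarrow> real ^ 'n) \<Rightarrow> real ^ 'n \<Rightarrow> real ^ 'n" where
  "upper_signature f x =
     (\<chi> i. if filterlim (\<lambda>t::real. f (1 + t *\<^sub>R x) $ i) at_top at_top then 1 else 0)"

definition lower_signature :: "(real ^ 'n \<Rightarrow> real ^ 'n) \<Rightarrow> real ^ 'n \<Rightarrow> real ^ 'n" where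
  "lower_signature f x = (\<chi> i. if f x $ i > 0 then 1 else 0)"

definition finite_limit_at :: "(real ^ 'n \<Rightarrow> real ^ 'n) \<Rightarrow> 'n set \<Rightarrow> 'n \<Rightarrow> bool" where
  "finite_limit_at f J i \<longleftrightarrow>
     (\<exists>L::real. ((\<lambda>t::real. f (1 + t *\<^sub>R ind_vec J) $ i) \<longlongrightarrow> L) at_top)"

definition closed_face :: "'n set \<Rightarrow> (real ^ 'n) set" where
  "closed_face J = {x \<in> nonneg_orthant. \<forall>i. i \<notin> J \<longrightarrow> x $ i = 0}"

definition orthant_part :: "'n set \<Rightarrow> (real ^ 'n) set" where
  "orthant_part J = {x \<in> nonneg_orthant. \<forall>i. x $ i > 0 \<longleftrightarrow> i \<in> J}"

definition facially_irreducible :: "(real ^ 'n \<Rightarrow> real ^ 'n) \<Rightarrow> bool" where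
  "facially_irreducible f \<longleftrightarrow>
     \<not> (\<exists>J. J \<noteq> {} \<and> J \<subset> UNIV \<and> f ` closed_face J \<subseteq> closed_face J)"

definition partially_irreducible :: "(real ^ 'n \<Rightarrow> real ^ 'n) \<Rightarrow> bool" where
  "partially_irreducible f \<longleftrightarrow>
     \<not> (\<exists>J. J \<noteq> {} \<and> J \<subset> UNIV \<and> f ` orthant_part J \<subseteq> orthant_part J)"

definition decomposable :: "(real ^ 'n \<Rightarrow> real ^ 'n) \<Rightarrow> bool" where
  "decomposable f \<longleftrightarrow>
     (\<exists>J. J \<noteq> {} \<and> J \<subset> UNIV \<and> (\<forall>i. i \<notin> J \<longrightarrow> finite_limit_at f J i))"

definition indecomposable :: "(real ^ 'n \<Rightarrow> real ^ 'n) \<Rightarrow> bool" where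
  "indecomposable f \<longleftrightarrow> \<not> decomposable f"

definition imperturbable :: "(real ^ 'n \<Rightarrow> real ^ 'n) \<Rightarrow> bool" where
  "imperturbable f \<longleftrightarrow>
     \<not> (\<exists>I J. I \<noteq> {} \<and> J \<noteq> {} \<and> I \<subseteq> J \<and> J \<subset> UNIV \<and>
          (\<forall>i\<in>I. f (ind_vec I) $ i > 0) \<and>
          (\<forall>i. i \<notin> J \<longrightarrow> finite_limit_at f J i))"

end

theory Submission
  imports Defs
begin

text \<open>
  A point of the part \<open>P\<^sub>J\<close> lies between two positive multiples of the indicator of \<open>J\<close>, and a
  point of the face \<open>F\<^sub>J\<close> below one, so by homogeneity and monotonicity the supports of the images
  are governed by the lower signature. Along a ray \<open>1 + t *\<^sub>R ind_vec J\<close> each coordinate of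
  \<open>f\<close> is monotone, so it diverges exactly when it does not converge, which is what the
  upper signature records.
\<close>

lemma ind_vec_nth [simp]: "ind_vec J $ i = (if i \<in> J then 1 else 0)"
  by (simp add: ind_vec_def)

lemma ind_vec_in_nonneg_orthant [simp]: "ind_vec J \<in> nonneg_orthant"
  by (simp add: nonneg_orthant_def)

lemma ind_vec_le_ind_vec_iff [simp]: "ind_vec I \<le> ind_vec J \<longleftrightarrow> I \<subseteq> J"
  by (auto simp: less_eq_vec_def)

lemma nontrivial_ind_vec_iff [simp]: "nontrivial (ind_vec J) \<longleftrightarrow> J \<noteq> {} \<and> J \<subset> UNIV"
  by (auto simp: nontrivial_def binary_vecs_eq_range_ind_vec vec_eq_iff)

text \<open>Nontrivial binary vectors are the indicators of nonempty proper subsets. This trades the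
  quantifier over vectors in the theorem for the one over index sets in the definitions of
  irreducibility.\<close>

lemma ex_nontrivial_iff:
  "(\<exists>x. nontrivial x \<and> P x) \<longleftrightarrow> (\<exists>J. J \<noteq> {} \<and> J \<subset> UNIV \<and> P (ind_vec J))"
proof
  assume "\<exists>x. nontrivial x \<and> P x"
  then obtain x where x: "nontrivial x" "P x" by blast
  then obtain J where "x = ind_vec J"
    by (auto simp: nontrivial_def binary_vecs_eq_range_ind_vec)
  with x show "\<exists>J. J \<noteq> {} \<and> J \<subset> UNIV \<and> P (ind_vec J)" by auto
next
  assume "\<exists>J. J \<noteq> {} \<and> J \<subset> UNIV \<and> P (ind_vec J)"
  then show "\<exists>x. nontrivial x \<and> P x" using nontrivial_ind_vec_iff by blast
qed

lemma m_topicalD: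
  assumes "m_topical f"
  shows m_topical_nonneg: "x \<in> nonneg_orthant \<Longrightarrow> 0 \<le> f x $ i"
    and m_topical_mono:
      "x \<in> nonneg_orthant \<Longrightarrow> y \<in> nonneg_orthant \<Longrightarrow> x \<le> y \<Longrightarrow> f x $ i \<le> f y $ i"
    and m_topical_scaleR: "x \<in> nonneg_orthant \<Longrightarrow> c > 0 \<Longrightarrow> f (c *\<^sub>R x) = c *\<^sub>R f x"
  using assms unfolding m_topical_def
  by (auto simp: nonneg_orthant_def less_eq_vec_def image_subset_iff)

lemma closed_face_le_scaleR_ind_vec:
  assumes "x \<in> closed_face J"
  obtains c :: real where "c > 0" "x \<le> c *\<^sub>R ind_vec J"
proof
  \<comment> \<open>The norm bounds every coordinate; the summand 1 keeps the factor positive when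
    \<open>x\<close> is 0.\<close>
  show "1 + norm x > 0" by (rule add_pos_nonneg) auto
  show "x \<le> (1 + norm x) *\<^sub>R ind_vec J"
    using assms component_le_norm_cart[of x]
    by (auto simp: closed_face_def less_eq_vec_def) (smt (verit))
qed

lemma orthant_part_ge_scaleR_ind_vec:
  assumes "x \<in> orthant_part J"
  obtains c :: real where "c > 0" "c *\<^sub>R ind_vec J \<le> x"
proof
  \<comment> \<open>Inserting 1 makes the minimum meaningful, and positive, also for empty
    \<open>J\<close>.\<close>
  let ?S = "insert 1 ((\<lambda>i. x $ i) ` J)"
  show "Min ?S > 0"
    using assms by (auto simp: orthant_part_def)
  show "Min ?S *\<^sub>R ind_vec J \<le> x"
    using assms by (auto simp: orthant_part_def nonneg_orthant_def less_eq_vec_def)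
qed

lemma orthant_part_subset_closed_face: "orthant_part J \<subseteq> closed_face J"
  by (force simp: orthant_part_def closed_face_def nonneg_orthant_def order_less_le)

text \<open>Only this direction holds on a closed face: \<open>x\<close> may vanish somewhere on
  \<open>J\<close>, so no positive multiple of \<open>ind_vec J\<close> need lie below it.\<close>

lemma m_topical_pos_closed_face:
  assumes f: "m_topical f" and x: "x \<in> closed_face J" and pos: "f x $ i > 0"
  shows "f (ind_vec J) $ i > 0"
proof -
  obtain c :: real where c: "c > 0" "x \<le> c *\<^sub>R ind_vec J"
    using closed_face_le_scaleR_ind_vec[OF x] .
  have "f x $ i \<le> f (c *\<^sub>R ind_vec J) $ i"
    using x c by (intro m_topical_mono[OF f]) (auto simp: closed_face_def nonneg_orthant_def)
  also have "\<dots> = c * f (ind_vec J) $ i"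
    using c by (simp add: m_topical_scaleR[OF f])
  finally have "0 < c * f (ind_vec J) $ i" using pos by linarith
  then show ?thesis using c by (simp add: zero_less_mult_iff)
qed

text \<open>On a part, \<open>x\<close> has multiples of \<open>ind_vec J\<close> on both sides, so
  all images of points of the part have the same support.\<close>

lemma m_topical_pos_orthant_part_iff:
  assumes f: "m_topical f" and x: "x \<in> orthant_part J"
  shows "f x $ i > 0 \<longleftrightarrow> f (ind_vec J) $ i > 0"
proof
  assume "f x $ i > 0"
  then show "f (ind_vec J) $ i > 0"
    using m_topical_pos_closed_face[OF f] x orthant_part_subset_closed_face by blast
next
  assume pos: "f (ind_vec J) $ i > 0"
  obtain c :: real where c: "c > 0" "c *\<^sub>R ind_vec J \<le> x"
    using orthant_part_ge_scaleR_ind_vec[OF x] .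
  have "0 < c * f (ind_vec J) $ i" using c pos by simp
  also have "\<dots> = f (c *\<^sub>R ind_vec J) $ i"
    using c by (simp add: m_topical_scaleR[OF f])
  also have "\<dots> \<le> f x $ i"
    using x c by (intro m_topical_mono[OF f]) (auto simp: orthant_part_def nonneg_orthant_def)
  finally show "f x $ i > 0" .
qed

lemma lower_signature_le_ind_vec_iff:
  "lower_signature f x \<le> ind_vec J \<longleftrightarrow> (\<forall>i. f x $ i > 0 \<longrightarrow> i \<in> J)"
  by (auto simp: lower_signature_def less_eq_vec_def)

lemma ind_vec_le_lower_signature_iff:
  "ind_vec J \<le> lower_signature f x \<longleftrightarrow> (\<forall>i\<in>J. f x $ i > 0)"
  by (auto simp: lower_signature_def less_eq_vec_def)

lemma m_topical_closed_face_invariant_iff: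
  assumes f: "m_topical f"
  shows "f ` closed_face J \<subseteq> closed_face J \<longleftrightarrow> lower_signature f (ind_vec J) \<le> ind_vec J"
proof -
  have "f x \<in> closed_face J \<longleftrightarrow> (\<forall>i. f x $ i > 0 \<longrightarrow> i \<in> J)" if "x \<in> closed_face J" for x
  proof -
    have "0 \<le> f x $ i" for i
      using that m_topical_nonneg[OF f] by (auto simp: closed_face_def)
    then show ?thesis
      by (force simp: closed_face_def nonneg_orthant_def order_less_le)
  qed
  \<comment> \<open>The indicator is itself a point of the face, and by
    \<open>m_topical_pos_closed_face\<close> its image has the largest support, so it alone decides
    invariance.\<close>
  moreover have "ind_vec J \<in> closed_face J" by (simp add: closed_face_def)
  ultimately show ?thesis
    using m_topical_pos_closed_face[OF f]
    unfolding lower_signature_le_ind_vec_iff image_subset_iff by blast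
qed

lemma m_topical_orthant_part_invariant_iff:
  assumes f: "m_topical f"
  shows "f ` orthant_part J \<subseteq> orthant_part J \<longleftrightarrow> lower_signature f (ind_vec J) = ind_vec J"
proof -
  \<comment> \<open>The right-hand side does not mention \<open>x\<close>: since the part is
    nonempty, one point decides invariance.\<close>
  have "f x \<in> orthant_part J \<longleftrightarrow> lower_signature f (ind_vec J) = ind_vec J"
    if "x \<in> orthant_part J" for x
  proof -
    have "f x \<in> nonneg_orthant"
      using that f by (auto simp: orthant_part_def m_topical_def)
    then show ?thesis
      using m_topical_pos_orthant_part_iff[OF f that]
      by (auto simp: orthant_part_def lower_signature_def vec_eq_iff)
  qed
  moreover have "ind_vec J \<in> orthant_part J" by (simp add: orthant_part_def)
  ultimately show ?thesis unfolding image_subset_iff by blast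
qed

text \<open>If \<open>g\<close> is bounded above on \<open>{a..}\<close>, it converges to its
  supremum there; otherwise it exceeds any given bound at some point and, by monotonicity, from then
  on.\<close>

lemma mono_on_not_at_top_iff_convergent:
  fixes g :: "real \<Rightarrow> real"
  assumes mono: "mono_on {a..} g"
  shows "\<not> filterlim g at_top at_top \<longleftrightarrow> (\<exists>L. (g \<longlongrightarrow> L) at_top)"
proof
  assume "\<exists>L. (g \<longlongrightarrow> L) at_top"
  then show "\<not> filterlim g at_top at_top"
    using not_tendsto_and_filterlim_at_infinity[OF trivial_limit_at_top_linorder]
      filterlim_at_top_imp_at_infinity by blast
next
  assume ninf: "\<not> filterlim g at_top at_top"
  have bdd: "bdd_above (g ` {a..})"
  proof (rule ccontr)
    assume unbdd: "\<not> bdd_above (g ` {a..})"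
    have "eventually (\<lambda>t. Z \<le> g t) at_top" for Z
    proof -
      obtain s where s: "s \<ge> a" "g s > Z"
        using unbdd by (force simp: bdd_above_def not_le)
      have "Z \<le> g t" if "t \<ge> s" for t
        using mono_onD[OF mono, of s t] s that by auto
      then show ?thesis by (auto simp: eventually_at_top_linorder)
    qed
    then show False using ninf by (simp add: filterlim_at_top)
  qed
  have "(g \<longlongrightarrow> (SUP t\<in>{a..}. g t)) at_top"
  proof (rule increasing_tendsto)
    show "eventually (\<lambda>t. g t \<le> (SUP t\<in>{a..}. g t)) at_top"
      using eventually_ge_at_top[of a] by eventually_elim (auto intro: cSUP_upper bdd)
    fix y assume "y < (SUP t\<in>{a..}. g t)"
    then obtain s where s: "s \<ge> a" "y < g s"
      using less_cSUP_iff[OF _ bdd] by auto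
    then have "y < g t" if "t \<ge> s" for t
      using mono_onD[OF mono, of s t] that by auto
    then show "eventually (\<lambda>t. y < g t) at_top"
      by (auto simp: eventually_at_top_linorder)
  qed
  then show "\<exists>L. (g \<longlongrightarrow> L) at_top" by blast
qed

text \<open>Inside \<open>J\<close> the inequality is automatic, as signature entries are at most 1.
  Outside \<open>J\<close> it excludes divergence, which for a monotone coordinate amounts to
  convergence.\<close>

lemma m_topical_upper_signature_le_ind_vec_iff:
  assumes f: "m_topical f"
  shows "upper_signature f (ind_vec J) \<le> ind_vec J \<longleftrightarrow> (\<forall>i. i \<notin> J \<longrightarrow> finite_limit_at f J i)"
proof -
  have "finite_limit_at f J i \<longleftrightarrow>
      \<not> filterlim (\<lambda>t::real. f (1 + t *\<^sub>R ind_vec J) $ i) at_top at_top" for i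
  proof -
    \<comment> \<open>The restriction to nonnegative \<open>t\<close> keeps the ray in the orthant,
      where \<open>f\<close> is known to be monotone.\<close>
    have "mono_on {0..} (\<lambda>t::real. f (1 + t *\<^sub>R ind_vec J) $ i)"
      by (intro mono_onI m_topical_mono[OF f])
         (auto simp: nonneg_orthant_def less_eq_vec_def)
    from mono_on_not_at_top_iff_convergent[OF this] show ?thesis
      by (simp add: finite_limit_at_def)
  qed
  then show ?thesis
    by (auto simp: upper_signature_def less_eq_vec_def)
qed

theorem proposition4p2:
  fixes f :: "real ^ 'n \<Rightarrow> real ^ 'n"
  assumes "m_topical f"
  shows
    "(facially_irreducible f \<longleftrightarrow>
        \<not> (\<exists>x. nontrivial x \<and> lower_signature f x \<le> x)) \<and>
     (indecomposable f \<longleftrightarrow>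
        \<not> (\<exists>x. nontrivial x \<and> upper_signature f x \<le> x)) \<and>
     (partially_irreducible f \<longleftrightarrow>
        \<not> (\<exists>x. nontrivial x \<and> lower_signature f x = x)) \<and>
     (imperturbable f \<longleftrightarrow>
        \<not> (\<exists>x y. nontrivial x \<and> nontrivial y \<and> x \<le> y \<and>
              lower_signature f x \<ge> x \<and> upper_signature f y \<le> y))"
proof (intro conjI)
  show "facially_irreducible f \<longleftrightarrow>
      \<not> (\<exists>x. nontrivial x \<and> lower_signature f x \<le> x)"
    unfolding facially_irreducible_def ex_nontrivial_iff
      m_topical_closed_face_invariant_iff[OF assms] ..
  show "indecomposable f \<longleftrightarrow>
      \<not> (\<exists>x. nontrivial x \<and> upper_signature f x \<le> x)"
    unfolding indecomposable_def decomposable_def ex_nontrivial_iff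
      m_topical_upper_signature_le_ind_vec_iff[OF assms] ..
  show "partially_irreducible f \<longleftrightarrow>
      \<not> (\<exists>x. nontrivial x \<and> lower_signature f x = x)"
    unfolding partially_irreducible_def ex_nontrivial_iff
      m_topical_orthant_part_invariant_iff[OF assms] ..
  \<comment> \<open>Nesting the quantifiers puts each one in the form that
    \<open>ex_nontrivial_iff\<close> rewrites, first for \<open>x\<close> and then for
    \<open>y\<close>.\<close>
  have "(\<exists>x y. nontrivial x \<and> nontrivial y \<and> x \<le> y \<and>
          lower_signature f x \<ge> x \<and> upper_signature f y \<le> y) \<longleftrightarrow>
      (\<exists>x. nontrivial x \<and> (\<exists>y. nontrivial y \<and> x \<le> y \<and>
          lower_signature f x \<ge> x \<and> upper_signature f y \<le> y))"
    by blast
  also have "\<dots> \<longleftrightarrow> (\<exists>I J. I \<noteq> {} \<and> J \<noteq> {} \<and> I \<subseteq> J \<and> J \<subset> UNIV \<and>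
      (\<forall>i\<in>I. f (ind_vec I) $ i > 0) \<and> (\<forall>i. i \<notin> J \<longrightarrow> finite_limit_at f J i))"
    unfolding ex_nontrivial_iff ind_vec_le_ind_vec_iff ind_vec_le_lower_signature_iff
      m_topical_upper_signature_le_ind_vec_iff[OF assms] by blast
  finally show "imperturbable f \<longleftrightarrow>
      \<not> (\<exists>x y. nontrivial x \<and> nontrivial y \<and> x \<le> y \<and>
            lower_signature f x \<ge> x \<and> upper_signature f y \<le> y)"
    unfolding imperturbable_def by blast
qed

end
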